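(* Let $\mathcal{G}$ be a directed acyclic graph (DAG) with vertex set $\{T,Y,X,U\}$ such that $Y$ is not an ancestor of $T$ in $\mathcal{G}$, and such that $X$ is a common cause of $T$ and $Y$, i.e. both edges $X\to T$ and $X\to Y$ are in $\mathcal{G}$. Let $K\ge 1$ environments be given, with $N_k\ge 2$ observations in environment $k$. Suppose the data are generated by the hierarchical multi-environment model with shared causal graph $\mathcal{G}$ and non-degenerate, pairwise independent random causal mechanisms $\Theta_T^{(k)},\Theta_Y^{(k)},\Theta_X^{(k)},\Theta_U^{(k)}$ (as defined in the context), and that the resulting joint distribution $P$ satisfies the causal Markov property and faithfulness with respect to the augmented DAG $\mathcal{G}^*$ (as defined in the context). Then, for any $k\in\{1,\dots,K\}$, there is hidden confounding between $T$ and $Y$ in $\mathcal{G}$ (i.e. both edges $U\to T$ and $U\to Y$ are in $\mathcal{G}$) if and only if, for all $i,j\in\{1,\dots,N_k\}$ with $i\ne j$, the variables $T_j^{(k)}$ and $Y_i^{(k)}$ are not conditionally independent given $\left(T_i^{(k)},X_i^{(k)},X_j^{(k)}\right)$ under $P$: $$T_j^{(k)}\not\perp\!\!\!\perp_P Y_i^{(k)}\mid T_i^{(k)},X_i^{(k)},X_j^{(k)}\qquad \forall\, i,j=1,\dots,N_k:\ i\neq j .$$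
   Context: Variables: $T$ (treatment) and $Y$ (outcome) are one-dimensional; $X$ (observed covariates) and $U$ (unobserved covariates) may have arbitrary dimension, each being treated as a single vertex. $\mathrm{Pa}(V)$ denotes the set of parents of $V$ in the DAG under consideration. Hierarchical multi-environment model. All environments $k=1,\dots,K$ share the same causal DAG $\mathcal{G}$ on $\{T,Y,X,U\}$. For each $V\in\{T,Y,X,U\}$ the causal mechanism (the conditional distribution of $V$ given its parents in $\mathcal{G}$) is parametrized by a random variable $\Theta_V$ with a non-degenerate distribution $P(\Theta_V)$, and $\Theta_T,\Theta_Y,\Theta_X,\Theta_U$ are pairwise independent. For each environment $k$ one draws, i.i.d. over $k$, mechanisms $\Theta_V^{(k)}\sim P(\Theta_V)$, $V\in\{T,Y,X,U\}$; then, conditionally on these mechanisms, the observations $(T_i^{(k)},Y_i^{(k)},X_i^{(k)},U_i^{(k)})$, $i=1,\dots,N_k$, are drawn i.i.d. from the distribution with causal factorization $$\prod_{V\in\{T,Y,X,U\}}P_{\Theta_V^{(k)}}(V\mid \mathrm{Pa}(V)).$$ The numbers $N_k$ are fixed. $P$ denotes the resulting joint distribution of the mechanisms and all observations; conditional independence statements about observations are with respect to $P$ and do not condition on the mechanisms or on the environment. Augmented DAG $\mathcal{G}^*$: its vertices are $\Theta_V^{(k)}$ and $V_i^{(k)}$ for $V\in\{T,Y,X,U\}$, $k=1,\dots,K$, $i=1,\dots,N_k$. For each $(i,k)$ the edges among $T_i^{(k)},Y_i^{(k)},X_i^{(k)},U_i^{(k)}$ are the same as those among $T,Y,X,U$ in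 $\mathcal{G}$; in addition there is an edge $\Theta_V^{(k)}\to V_i^{(k)}$ for all $V,i,k$; there are no other edges. Causal Markov property and faithfulness with respect to $\mathcal{G}^*$: for all disjoint sets $\mathbf{A},\mathbf{B},\mathbf{C}$ of vertices of $\mathcal{G}^*$, $\mathbf{A}$ and $\mathbf{B}$ are conditionally independent given $\mathbf{C}$ under $P$ if $\mathbf{A}$ and $\mathbf{B}$ are d-separated by $\mathbf{C}$ in $\mathcal{G}^*$ (causal Markov property), and only if they are (faithfulness). $\perp\!\!\!\perp_P$ denotes (conditional) independence under $P$. *)

theory Defs
  imports "HOL-Probability.Probability"
begin

section \<open>Directed graphs and d-separation\<close>

text \<open>A directed graph is given by its edge relation \<open>E\<close>; it is a DAG iff \<open>acyclic E\<close>.\<close>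

definition parents :: "('v \<times> 'v) set \<Rightarrow> 'v \<Rightarrow> 'v set" where
  "parents E v = {u. (u, v) \<in> E}"

definition path_between :: "('v \<times> 'v) set \<Rightarrow> 'v \<Rightarrow> 'v list \<Rightarrow> 'v \<Rightarrow> bool" where
  "path_between E a p b \<longleftrightarrow>
     p \<noteq> [] \<and> hd p = a \<and> last p = b \<and> distinct p \<and>
     successively (\<lambda>u v. (u, v) \<in> E \<or> (v, u) \<in> E) p"

definition collider :: "('v \<times> 'v) set \<Rightarrow> 'v list \<Rightarrow> nat \<Rightarrow> bool" where
  "collider E p m \<longleftrightarrow> (p ! (m - 1), p ! m) \<in> E \<and> (p ! (m + 1), p ! m) \<in> E"

text \<open>A collider blocks iff neither it nor any of its descendants is in \<open>C\<close>;
  the reflexive closure \<open>E\<^sup>*\<close> covers both.\<close>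

definition blocked :: "('v \<times> 'v) set \<Rightarrow> 'v set \<Rightarrow> 'v list \<Rightarrow> bool" where
  "blocked E C p \<longleftrightarrow>
     (\<exists>m. 0 < m \<and> m + 1 < length p \<and>
        (if collider E p m then \<forall>c\<in>C. (p ! m, c) \<notin> E\<^sup>* else p ! m \<in> C))"

definition d_separated :: "('v \<times> 'v) set \<Rightarrow> 'v set \<Rightarrow> 'v set \<Rightarrow> 'v set \<Rightarrow> bool" where
  "d_separated E A B C \<longleftrightarrow> (\<forall>a\<in>A. \<forall>b\<in>B. \<forall>p. path_between E a p b \<longrightarrow> blocked E C p)"


section \<open>Conditional independence, Markov property and faithfulness\<close>

text \<open>\<open>F v\<close> is the \<open>\<sigma>\<close>-algebra generated by the random variable sitting at vertex \<open>v\<close>.\<close>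

definition joint_algebra :: "'w measure \<Rightarrow> ('v \<Rightarrow> 'w measure) \<Rightarrow> 'v set \<Rightarrow> 'w measure" where
  "joint_algebra M F A = sigma (space M) (\<Union>v\<in>A. sets (F v))"

definition cond_indep ::
  "'w measure \<Rightarrow> ('v \<Rightarrow> 'w measure) \<Rightarrow> 'v set \<Rightarrow> 'v set \<Rightarrow> 'v set \<Rightarrow> bool" where
  "cond_indep M F A B C \<longleftrightarrow>
     (\<forall>a \<in> sets (joint_algebra M F A). \<forall>b \<in> sets (joint_algebra M F B).
        AE w in M.
          real_cond_exp M (joint_algebra M F C) (indicator (a \<inter> b)) w =
          real_cond_exp M (joint_algebra M F C) (indicator a) w *
          real_cond_exp M (joint_algebra M F C) (indicator b) w)"

definition causal_markov ::
  "'w measure \<Rightarrow> ('v \<Rightarrow> 'w measure) \<Rightarrow> 'v set \<Rightarrow> ('v \<times> 'v) set \<Rightarrow> bool" where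
  "causal_markov M F V E \<longleftrightarrow>
     (\<forall>A B C. A \<subseteq> V \<and> B \<subseteq> V \<and> C \<subseteq> V \<and> A \<inter> B = {} \<and> A \<inter> C = {} \<and> B \<inter> C = {} \<longrightarrow>
        d_separated E A B C \<longrightarrow> cond_indep M F A B C)"

definition faithful ::
  "'w measure \<Rightarrow> ('v \<Rightarrow> 'w measure) \<Rightarrow> 'v set \<Rightarrow> ('v \<times> 'v) set \<Rightarrow> bool" where
  "faithful M F V E \<longleftrightarrow>
     (\<forall>A B C. A \<subseteq> V \<and> B \<subseteq> V \<and> C \<subseteq> V \<and> A \<inter> B = {} \<and> A \<inter> C = {} \<and> B \<inter> C = {} \<longrightarrow>
        cond_indep M F A B C \<longrightarrow> d_separated E A B C)"


section \<open>The augmented DAG\<close>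

datatype var = T | Y | X | U

text \<open>\<open>Mech V k\<close> stands for \<open>\<Theta>\<^sub>V\<close> in environment \<open>k\<close>, and \<open>Obs V k i\<close> for the \<open>i\<close>-th
  observation of \<open>V\<close> in environment \<open>k\<close>. Environments are numbered \<open>1..K\<close> and
  observations \<open>1..N k\<close>.\<close>

datatype node = Mech var nat | Obs var nat nat

definition aug_vertices :: "nat \<Rightarrow> (nat \<Rightarrow> nat) \<Rightarrow> node set" where
  "aug_vertices K N =
     {Mech V k | V k. k \<in> {1..K}} \<union>
     {Obs V k i | V k i. k \<in> {1..K} \<and> i \<in> {1..N k}}"

definition aug_edges :: "(var \<times> var) set \<Rightarrow> nat \<Rightarrow> (nat \<Rightarrow> nat) \<Rightarrow> (node \<times> node) set" where
  "aug_edges E K N =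
     {(Obs V k i, Obs W k i) | V W k i. (V, W) \<in> E \<and> k \<in> {1..K} \<and> i \<in> {1..N k}} \<union>
     {(Mech V k, Obs V k i) | V k i. k \<in> {1..K} \<and> i \<in> {1..N k}}"


section \<open>The hierarchical multi-environment model\<close>

text \<open>The vertex \<open>V\<close> takes values in \<open>d V\<close>-dimensional Euclidean space with its Borel sets;
  vectors are extensional functions on \<open>{..<d V}\<close>, so that \<open>d\<close> may vary with \<open>V\<close>.\<close>

definition val_space :: "(var \<Rightarrow> nat) \<Rightarrow> var \<Rightarrow> (nat \<Rightarrow> real) measure" where
  "val_space d V = PiM {..<d V} (\<lambda>_. borel)"

definition row_space :: "(var \<Rightarrow> nat) \<Rightarrow> (var \<Rightarrow> nat \<Rightarrow> real) measure" where
  "row_space d = PiM UNIV (val_space d)"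

definition mech_space :: "(var \<Rightarrow> 'p measure) \<Rightarrow> (var \<Rightarrow> 'p) measure" where
  "mech_space S = PiM UNIV S"

text \<open>Reverse topological orders: every vertex comes before its parents.\<close>

fun rev_topological :: "(var \<times> var) set \<Rightarrow> var list \<Rightarrow> bool" where
  "rev_topological E [] \<longleftrightarrow> True"
| "rev_topological E (v # vs) \<longleftrightarrow>
     v \<notin> set vs \<and> parents E v \<subseteq> set vs \<and> rev_topological E vs"

text \<open>The distribution with causal factorization: \<open>\<kappa> V (\<theta>\<^sub>V, x)\<close> is the conditional
  distribution of \<open>V\<close> under the mechanism \<open>\<theta>\<^sub>V\<close>, given that its parents take the values \<open>x\<close>.
  The product of the conditional distributions is formed by sampling every vertex after
  its parents. For a reverse topological order enumerating all vertices the result does not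
  depend on the order.\<close>

fun causal_law ::
  "(var \<times> var) set \<Rightarrow> (var \<Rightarrow> nat) \<Rightarrow>
   (var \<Rightarrow> 'p \<times> (var \<Rightarrow> nat \<Rightarrow> real) \<Rightarrow> (nat \<Rightarrow> real) measure) \<Rightarrow>
   (var \<Rightarrow> 'p) \<Rightarrow> var list \<Rightarrow> (var \<Rightarrow> nat \<Rightarrow> real) measure" where
  "causal_law E d \<kappa> \<theta> [] = return (PiM {} (val_space d)) (\<lambda>_. undefined)"
| "causal_law E d \<kappa> \<theta> (v # vs) =
     causal_law E d \<kappa> \<theta> vs \<bind> (\<lambda>x.
     \<kappa> v (\<theta> v, restrict x (parents E v)) \<bind> (\<lambda>y.
     return (PiM (set (v # vs)) (val_space d)) (x(v := y))))"

text \<open>\<open>S V\<close> is the parameter space of the mechanism of \<open>V\<close>, and \<open>\<mu>\<close> the joint law of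
  \<open>(\<Theta>\<^sub>T, \<Theta>\<^sub>Y, \<Theta>\<^sub>X, \<Theta>\<^sub>U)\<close>. \<open>\<Theta> V k\<close> and \<open>Z V k i\<close> are the random variables at the
  vertices \<open>Mech V k\<close> and \<open>Obs V k i\<close>.\<close>

locale hierarchical_model = prob_space M
  for M :: "'w measure" +
  fixes E :: "(var \<times> var) set"
    and K :: nat
    and N :: "nat \<Rightarrow> nat"
    and d :: "var \<Rightarrow> nat"
    and S :: "var \<Rightarrow> 'p measure"
    and \<mu> :: "(var \<Rightarrow> 'p) measure"
    and \<kappa> :: "var \<Rightarrow> 'p \<times> (var \<Rightarrow> nat \<Rightarrow> real) \<Rightarrow> (nat \<Rightarrow> real) measure"
    and \<Theta> :: "var \<Rightarrow> nat \<Rightarrow> 'w \<Rightarrow> 'p"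
    and Z :: "var \<Rightarrow> nat \<Rightarrow> nat \<Rightarrow> 'w \<Rightarrow> nat \<Rightarrow> real"
  assumes one_dimensional: "d T = 1" "d Y = 1"
    and mechanism_law: "prob_space \<mu>" "sets \<mu> = sets (mech_space S)"
    and non_degenerate: "\<And>V \<theta>. \<theta> \<in> space (S V) \<Longrightarrow> distr \<mu> (S V) (\<lambda>t. t V) \<noteq> return (S V) \<theta>"
    and pairwise_indep:
      "\<And>V W. V \<noteq> W \<Longrightarrow> prob_space.indep_var \<mu> (S V) (\<lambda>t. t V) (S W) (\<lambda>t. t W)"
    and kernel:
      "\<And>V. \<kappa> V \<in> S V \<Otimes>\<^sub>M PiM (parents E V) (val_space d) \<rightarrow>\<^sub>M prob_algebra (val_space d V)"
    and measurable_mech: "\<And>V k. k \<in> {1..K} \<Longrightarrow> \<Theta> V k \<in> M \<rightarrow>\<^sub>M S V"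
    and measurable_obs:
      "\<And>V k i. k \<in> {1..K} \<Longrightarrow> i \<in> {1..N k} \<Longrightarrow> Z V k i \<in> M \<rightarrow>\<^sub>M val_space d V"
    and joint_law:
      "\<exists>vs. rev_topological E vs \<and> set vs = UNIV \<and>
         (let L = PiM {1..K} (\<lambda>_. mech_space S)
                    \<Otimes>\<^sub>M PiM (SIGMA k:{1..K}. {1..N k}) (\<lambda>_. row_space d)
          in distr M L
               (\<lambda>w. (\<lambda>k\<in>{1..K}. \<lambda>V. \<Theta> V k w,
                     \<lambda>(k, i)\<in>(SIGMA k:{1..K}. {1..N k}). \<lambda>V. Z V k i w)) =
             PiM {1..K} (\<lambda>_. \<mu>) \<bind> (\<lambda>\<theta>.
             PiM (SIGMA k:{1..K}. {1..N k}) (\<lambda>(k, i). causal_law E d \<kappa> (\<theta> k) vs) \<bind> (\<lambda>z.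
             return L (\<theta>, z))))"

definition vertex_algebra ::
  "'w measure \<Rightarrow> (var \<Rightarrow> nat) \<Rightarrow> (var \<Rightarrow> 'p measure) \<Rightarrow> (var \<Rightarrow> nat \<Rightarrow> 'w \<Rightarrow> 'p) \<Rightarrow>
   (var \<Rightarrow> nat \<Rightarrow> nat \<Rightarrow> 'w \<Rightarrow> nat \<Rightarrow> real) \<Rightarrow> node \<Rightarrow> 'w measure" where
  "vertex_algebra M d S \<Theta> Z n =
     (case n of
        Mech V k \<Rightarrow> vimage_algebra (space M) (\<Theta> V k) (S V)
      | Obs V k i \<Rightarrow> vimage_algebra (space M) (Z V k i) (val_space d V))"

end

theory Submission imports Defs begin

text \<open>By the Markov property and faithfulness the claim is one about d-separation in the augmented DAG.
  A hidden confounder opens the path \<open>T\<^sub>j \<leftarrow> \<Theta>\<^sub>T \<rightarrow> T\<^sub>i \<leftarrow> U\<^sub>i \<rightarrow> Y\<^sub>i\<close>, whose collider \<open>T\<^sub>i\<close> is conditioned on.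
  Conversely, follow an unblocked path starting at \<open>T\<^sub>j\<close>. Without \<open>U \<rightarrow> Y\<close> it cannot enter \<open>Y\<^sub>i\<close>:
  \<open>X\<^sub>i\<close> and \<open>T\<^sub>i\<close> are conditioned on, \<open>\<Theta>\<^sub>Y\<close> is only accessible through a collider \<open>Y\<^sub>l\<close>, and a child \<open>U\<^sub>i\<close>
  of \<open>Y\<^sub>i\<close> is a sink. Without \<open>U \<rightarrow> T\<close> it cannot get past the vertices \<open>T\<^sub>i\<close> and \<open>X\<^sub>i\<close> into the rest of
  the \<open>i\<close>-th observation.\<close>

section \<open>Unblocked paths via consecutive triples\<close>

definition open_triple :: "('v \<times> 'v) set \<Rightarrow> 'v set \<Rightarrow> 'v \<Rightarrow> 'v \<Rightarrow> 'v \<Rightarrow> bool" where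
  "open_triple E C a b c \<longleftrightarrow>
     (if (a, b) \<in> E \<and> (c, b) \<in> E then \<exists>x\<in>C. (b, x) \<in> E\<^sup>* else b \<notin> C)"

lemma not_blocked_iff_open_triples:
  "\<not> blocked E C p \<longleftrightarrow>
     (\<forall>m. m + 2 < length p \<longrightarrow> open_triple E C (p ! m) (p ! (m + 1)) (p ! (m + 2)))"
  (is "?L \<longleftrightarrow> ?R")
proof
  assume ?L
  show ?R
  proof (intro allI impI)
    fix m assume "m + 2 < length p"
    then have "\<not> (if collider E p (Suc m) then \<forall>c\<in>C. (p ! Suc m, c) \<notin> E\<^sup>* else p ! Suc m \<in> C)"
      using \<open>?L\<close> unfolding blocked_def by fastforce
    then show "open_triple E C (p ! m) (p ! (m + 1)) (p ! (m + 2))"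
      by (auto simp: open_triple_def collider_def split: if_splits)
  qed
next
  assume R: ?R
  show ?L
  proof
    assume "blocked E C p"
    then obtain m where m: "0 < m" "m + 1 < length p"
      and b: "if collider E p m then \<forall>c\<in>C. (p ! m, c) \<notin> E\<^sup>* else p ! m \<in> C"
      unfolding blocked_def by blast
    from m obtain n where "m = Suc n" by (cases m) auto
    with m b R[rule_format, of n] show False
      by (auto simp: open_triple_def collider_def split: if_splits)
  qed
qed

text \<open>Induction along an unblocked path. The invariant \<open>R\<close> relates consecutive
  vertices, since whether a path may pass through \<open>v\<close> depends on the direction in which
  \<open>v\<close> was entered.\<close>

lemma d_separated_by_invariant:
  fixes E :: "('v \<times> 'v) set"
  defines "adj \<equiv> \<lambda>u v. (u, v) \<in> E \<or> (v, u) \<in> E"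
  assumes "a \<noteq> b"
    and start: "\<And>v. adj a v \<Longrightarrow> R a v"
    and step: "\<And>u v w. R u v \<Longrightarrow> adj u v \<Longrightarrow> adj v w \<Longrightarrow> open_triple E C u v w \<Longrightarrow> R v w"
    and target: "\<And>u. \<not> R u b"
  shows "d_separated E {a} {b} C"
proof -
  have "blocked E C p" if p: "path_between E a p b" for p
  proof (rule ccontr)
    assume nb: "\<not> blocked E C p"
    from p have p': "p \<noteq> []" "hd p = a" "last p = b" "successively adj p"
      by (auto simp: path_between_def adj_def)
    have adj: "adj (p ! m) (p ! (m + 1))" if "m + 1 < length p" for m
      using p'(4) that by (auto simp: successively_conv_nth)
    have R: "R (p ! m) (p ! (m + 1))" if "m + 1 < length p" for m
      using that
    proof (induction m)
      case 0
      then show ?case using start adj[of 0] p' by (simp add: hd_conv_nth)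
    next
      case (Suc m)
      then show ?case
        using step[of "p ! m" "p ! Suc m" "p ! Suc (Suc m)"] adj[of m] adj[of "Suc m"] nb
        by (simp add: not_blocked_iff_open_triples)
    qed
    \<comment> \<open>As \<open>a\<close> differs from \<open>b\<close>, the path has a last edge,
      and it enters \<open>b\<close>.\<close>
    have "length p \<ge> 2"
      using p' \<open>a \<noteq> b\<close> by (cases p rule: list.exhaust; cases "tl p") auto
    with R[of "length p - 2"] p' target[of "p ! (length p - 2)"] show False
      by (simp add: last_conv_nth numeral_2_eq_2 Suc_diff_Suc)
  qed
  then show ?thesis by (simp add: d_separated_def)
qed

lemma cond_indep_iff_d_separated:
  assumes "causal_markov M F V E" "faithful M F V E"
    and "A \<subseteq> V" "B \<subseteq> V" "C \<subseteq> V" "A \<inter> B = {}" "A \<inter> C = {}" "B \<inter> C = {}"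
  shows "cond_indep M F A B C \<longleftrightarrow> d_separated E A B C"
  using assms unfolding causal_markov_def faithful_def by metis

section \<open>Edges and descendants in the augmented DAG\<close>

lemma aug_edges_simps:
  "(Obs V k i, Obs W k' i') \<in> aug_edges E K N \<longleftrightarrow>
     (V, W) \<in> E \<and> k' = k \<and> i' = i \<and> k \<in> {1..K} \<and> i \<in> {1..N k}"
  "(Mech V k, Obs W k' i) \<in> aug_edges E K N \<longleftrightarrow>
     W = V \<and> k' = k \<and> k \<in> {1..K} \<and> i \<in> {1..N k}"
  "(n, Mech W k) \<notin> aug_edges E K N"
  unfolding aug_edges_def by auto

lemma aug_edges_rtrancl_Obs:
  assumes "(Obs V k i, n) \<in> (aug_edges E K N)\<^sup>*"
  obtains W where "n = Obs W k i" "(V, W) \<in> E\<^sup>*"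
proof -
  have "\<exists>W. n = Obs W k i \<and> (V, W) \<in> E\<^sup>*"
    using assms
  proof (induction rule: rtrancl_induct)
    case (step m n)
    then show ?case
      by (cases n) (auto simp: aug_edges_simps intro: rtrancl_into_rtrancl)
  qed simp
  then show thesis using that by blast
qed

lemma acyclic_rtrancl_edge:
  assumes "acyclic E" "(v, w) \<in> E\<^sup>*"
  shows "(w, v) \<notin> E"
  using assms by (meson acyclic_def rtrancl_into_trancl1)

lemma acyclic_rtrancl_edge2:
  assumes "acyclic E" "(v, w) \<in> E\<^sup>*" "(w, u) \<in> E"
  shows "(u, v) \<notin> E"
  using assms by (meson acyclic_rtrancl_edge rtrancl_into_rtrancl)

section \<open>d-separation of \<open>Obs T k j\<close> and \<open>Obs Y k i\<close>\<close>

context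
  fixes E :: "(var \<times> var) set" and K :: nat and N :: "nat \<Rightarrow> nat" and k i j :: nat
  assumes acyclic: "acyclic E"
    and Y_T: "(Y, T) \<notin> E\<^sup>+"
    and X_T: "(X, T) \<in> E" and X_Y: "(X, Y) \<in> E"
    and k: "k \<in> {1..K}" and i: "i \<in> {1..N k}" and j: "j \<in> {1..N k}" and ij: "i \<noteq> j"
begin

private abbreviation (input) G where "G \<equiv> aug_edges E K N"
private abbreviation (input) C where "C \<equiv> {Obs T k i, Obs X k i, Obs X k j}"

private lemma no_edge:
  "(Y, T) \<notin> E" "(Y, X) \<notin> E" "(T, X) \<notin> E" "(V, V) \<notin> E"
  using acyclic Y_T X_T X_Y acyclic_rtrancl_edge[OF acyclic, of X] acyclic_rtrancl_edge[OF acyclic, of V V]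
  by (blast intro: r_into_rtrancl)+

private lemma no_directed_path:
  "(T, X) \<notin> E\<^sup>*" "(Y, X) \<notin> E\<^sup>*" "(Y, T) \<notin> E\<^sup>*"
  using Y_T acyclic_rtrancl_edge[OF acyclic] X_T X_Y by (auto simp: rtrancl_eq_or_trancl)

private lemma G_asym: "(u, v) \<in> G \<Longrightarrow> (v, u) \<notin> G"
  by (cases u; cases v) (auto simp: aug_edges_simps dest: acyclic_rtrancl_edge[OF acyclic, OF r_into_rtrancl])

text \<open>An edge leaving \<open>v\<close> prevents \<open>v\<close> from being a collider, as
  edges of the augmented DAG are never reversed.\<close>

private lemma open_tripleD_tail:
  assumes "open_triple G C u v w" "(v, u) \<in> G \<or> (v, w) \<in> G"
  shows "v \<notin> C"
  using assms G_asym by (auto simp: open_triple_def split: if_splits)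

text \<open>Descendants stay within one observation, and the only \<open>T\<close> in the
  conditioning set is that of the \<open>i\<close>-th.\<close>

private lemma open_tripleD_collider:
  assumes "open_triple G C u (Obs V k' l) w" "(u, Obs V k' l) \<in> G" "(w, Obs V k' l) \<in> G"
  shows "(V, X) \<in> E\<^sup>* \<or> (V, T) \<in> E\<^sup>* \<and> l = i"
proof -
  from assms obtain x where "x \<in> C" "(Obs V k' l, x) \<in> G\<^sup>*"
    by (auto simp: open_triple_def)
  moreover from this(2) obtain W where "x = Obs W k' l" "(V, W) \<in> E\<^sup>*"
    by (rule aug_edges_rtrancl_Obs)
  ultimately show ?thesis by auto
qed

private lemma d_separated_if_no_edge_U_Y:
  assumes U_Y: "(U, Y) \<notin> E"
  shows "d_separated G {Obs T k j} {Obs Y k i} C"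
proof (rule d_separated_by_invariant
    [where R = "\<lambda>u v. v \<noteq> Mech Y k \<and> v \<noteq> Obs Y k i \<and> (\<forall>l. v = Obs Y k l \<longrightarrow> (u, v) \<in> G)"])
  fix v assume "(Obs T k j, v) \<in> G \<or> (v, Obs T k j) \<in> G"
  then show "v \<noteq> Mech Y k \<and> v \<noteq> Obs Y k i \<and> (\<forall>l. v = Obs Y k l \<longrightarrow> (Obs T k j, v) \<in> G)"
    using ij no_edge by (cases v) (auto simp: aug_edges_simps)
next
  fix u v w
  assume uv: "v \<noteq> Mech Y k \<and> v \<noteq> Obs Y k i \<and> (\<forall>l. v = Obs Y k l \<longrightarrow> (u, v) \<in> G)"
    and adj: "(u, v) \<in> G \<or> (v, u) \<in> G" "(v, w) \<in> G \<or> (w, v) \<in> G"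
    and op: "open_triple G C u v w"
  \<comment> \<open>Edges from \<open>U\<close> to \<open>T\<close> or \<open>X\<close> would make
    \<open>Y\<close> an ancestor of \<open>T\<close> or \<open>X\<close>.\<close>
  have U_sink: "(U, V) \<notin> E" if "(Y, U) \<in> E" for V
    using that U_Y no_edge(4) no_directed_path(2,3)
      rtrancl_into_rtrancl[OF r_into_rtrancl[OF that], of V]
    by (cases V) auto
  \<comment> \<open>A sink inside a path is a collider, and its only descendant is itself, outside
    the conditioning set.\<close>
  have U_notin_path: "v \<noteq> Obs U k l" if "(Y, U) \<in> E" for l
  proof
    assume v: "v = Obs U k l"
    have "(u, v) \<in> G" "(w, v) \<in> G"
      using adj v U_sink[OF that] by (cases u; cases w; auto simp: aug_edges_simps)+
    moreover have "V = U" if "(U, V) \<in> E\<^sup>*" for V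
      using that U_sink[OF \<open>(Y, U) \<in> E\<close>] by (cases rule: converse_rtranclE) auto
    ultimately show False
      using open_tripleD_collider[of u U k l w] op v by blast
  qed
  \<comment> \<open>By the invariant, \<open>Obs Y k l\<close> was entered along an arrow, so
    turning to its mechanism makes it a collider; but \<open>Y\<close> is an ancestor of neither
    \<open>T\<close> nor \<open>X\<close>.\<close>
  have "w \<noteq> Mech Y k"
  proof
    assume w: "w = Mech Y k"
    then obtain l where v: "v = Obs Y k l"
      using adj(2) by (cases v) (auto simp: aug_edges_simps)
    then show False
      using open_tripleD_collider[of u Y k l w] op uv w adj(2) no_directed_path
      by (auto simp: aug_edges_simps)
  qed
  moreover have "(v, w) \<in> G" if w: "w = Obs Y k l" for l
  proof (rule ccontr)
    assume "(v, w) \<notin> G"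
    then have "v = Obs U k l \<and> (Y, U) \<in> E"
      \<comment> \<open>The second case split is on the variable observed at \<open>v\<close>;
        \<open>Y\<close> is a dummy value for mechanisms.\<close>
      using adj(2) w no_edge by (cases v; cases "case v of Obs V _ _ \<Rightarrow> V | _ \<Rightarrow> Y") (auto simp: aug_edges_simps)
    then show False using U_notin_path by blast
  qed
  moreover have "w \<noteq> Obs Y k i"
  proof
    assume w: "w = Obs Y k i"
    then have vw: "(v, w) \<in> G" using calculation(2) by blast
    \<comment> \<open>Of the possible parents of \<open>Obs Y k i\<close>, the mechanism is excluded
      by the invariant and \<open>U\<close> by assumption.\<close>
    have "v \<in> C"
      using vw w uv U_Y no_edge
      by (cases v; cases "case v of Obs V _ _ \<Rightarrow> V | _ \<Rightarrow> Y") (auto simp: aug_edges_simps)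
    then show False using open_tripleD_tail[OF op] vw by blast
  qed
  ultimately show "w \<noteq> Mech Y k \<and> w \<noteq> Obs Y k i \<and> (\<forall>l. w = Obs Y k l \<longrightarrow> (v, w) \<in> G)"
    by blast
qed auto

private lemma d_separated_if_no_edge_U_T:
  assumes U_Y: "(U, Y) \<in> E" and U_T: "(U, T) \<notin> E"
  shows "d_separated G {Obs T k j} {Obs Y k i} C"
proof -
  \<comment> \<open>All edges an unblocked path can use: to the mechanism of \<open>T\<close>, from
    it to some \<open>T\<close>, backwards into the conditioning set (a dead end), or forwards into
    a \<open>Y\<close> or a child \<open>U\<close> of \<open>T\<close> in an observation other than
    the \<open>i\<close>-th.\<close>
  define R where "R u v \<longleftrightarrow> v = Mech T k \<or> u = Mech T k \<and> (\<exists>l. v = Obs T k l) \<or>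
      v \<in> C \<and> (v, u) \<in> G \<or>
      (\<exists>l. l \<noteq> i \<and> (v = Obs Y k l \<or> v = Obs U k l \<and> (T, U) \<in> E) \<and> (u, v) \<in> G)" for u v
  have Y_sink: "(Y, V) \<notin> E" for V
    using no_edge U_Y acyclic_rtrancl_edge[OF acyclic, OF r_into_rtrancl, of U Y] by (cases V) auto
  show ?thesis
  proof (rule d_separated_by_invariant[where R = R])
    fix v assume "(Obs T k j, v) \<in> G \<or> (v, Obs T k j) \<in> G"
    then show "R (Obs T k j) v"
      using ij no_edge U_T
      by (cases v; cases "case v of Obs V _ _ \<Rightarrow> V | _ \<Rightarrow> Y") (auto simp: aug_edges_simps R_def)
  next
    fix u v w
    assume R: "R u v" and adj: "(u, v) \<in> G \<or> (v, u) \<in> G" "(v, w) \<in> G \<or> (w, v) \<in> G"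
      and op: "open_triple G C u v w"
    from R consider (Mech) "v = Mech T k"
      | (T) l where "u = Mech T k" "v = Obs T k l"
      | (C) "v \<in> C" "(v, u) \<in> G"
      | (Y) l where "l \<noteq> i" "v = Obs Y k l" "(u, v) \<in> G"
      | (U) l where "l \<noteq> i" "v = Obs U k l" "(T, U) \<in> E" "(u, v) \<in> G"
      unfolding R_def by blast
    then show "R v w"
    proof cases
      case Mech
      then show ?thesis using adj(2) by (cases w) (auto simp: aug_edges_simps R_def)
    next
      case T
      have uv: "(u, v) \<in> G" using adj(1) T by (auto simp: aug_edges_simps)
      show ?thesis
      proof (cases "(v, w) \<in> G")
        case True
        then have "l \<noteq> i" using open_tripleD_tail[OF op] T by auto
        with True T no_edge show ?thesis
          by (cases w; cases "case w of Obs V _ _ \<Rightarrow> V | _ \<Rightarrow> Y") (auto simp: aug_edges_simps R_def)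
      next
        case False
        then have wv: "(w, v) \<in> G" using adj(2) by blast
        \<comment> \<open>Leaving against an arrow makes \<open>Obs T k l\<close> a collider, open
          only for \<open>l = i\<close>; without \<open>U\<close> as a parent, the path then returns
          to the mechanism or ends up in the conditioned \<open>Obs X k i\<close>.\<close>
        have "l = i"
          using open_tripleD_collider[of u T k l w] op uv wv T no_directed_path by blast
        then show ?thesis using wv T no_edge U_T
          by (cases w; cases "case w of Obs V _ _ \<Rightarrow> V | _ \<Rightarrow> Y") (auto simp: aug_edges_simps R_def)
      qed
    next
      case C
      then show ?thesis using open_tripleD_tail[OF op] by blast
    next
      case Y
      have "(w, v) \<in> G" using adj(2) Y Y_sink by (cases w) (auto simp: aug_edges_simps)
      then show ?thesis
        using open_tripleD_collider[of u Y k l w] op Y no_directed_path by blast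
    next
      case U
      \<comment> \<open>A directed path from \<open>U\<close> to \<open>X\<close> would close a
        cycle through the edges from \<open>X\<close> to \<open>T\<close> and from \<open>T\<close>
        to \<open>U\<close>.\<close>
      have U_X: "(U, X) \<notin> E\<^sup>*"
        using acyclic_rtrancl_edge2[OF acyclic _ X_T] U by blast
      have "(w, v) \<notin> G"
        using open_tripleD_collider[of u U k l w] op U U_X by blast
      then have "(v, w) \<in> G" using adj(2) by blast
      then show ?thesis using U U_X U_T no_edge
        by (cases w; cases "case w of Obs V _ _ \<Rightarrow> V | _ \<Rightarrow> Y") (auto simp: aug_edges_simps R_def)
    qed
  next
    show "\<not> R u (Obs Y k i)" for u unfolding R_def by auto
  qed auto
qed

private lemma not_d_separated_if_confounded:
  assumes U_T: "(U, T) \<in> E" and U_Y: "(U, Y) \<in> E"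
  shows "\<not> d_separated G {Obs T k j} {Obs Y k i} C"
proof -
  let ?p = "[Obs T k j, Mech T k, Obs T k i, Obs U k i, Obs Y k i]"
  have "path_between G (Obs T k j) ?p (Obs Y k i)"
    using U_T U_Y k i j ij by (auto simp: path_between_def aug_edges_simps)
  moreover have "\<not> blocked G C ?p"
    unfolding not_blocked_iff_open_triples
  proof (intro allI impI)
    fix m assume "m + 2 < length ?p"
    \<comment> \<open>The middle vertices are the fork \<open>Mech T k\<close>, the conditioned
      collider \<open>Obs T k i\<close> and the unconditioned \<open>Obs U k i\<close>, which is no
      collider by acyclicity.\<close>
    then have "m = 0 \<or> m = 1 \<or> m = 2" by auto
    then show "open_triple G C (?p ! m) (?p ! (m + 1)) (?p ! (m + 2))"
      using acyclic_rtrancl_edge[OF acyclic, OF r_into_rtrancl, OF U_T] U_T k i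
      by (auto simp: open_triple_def aug_edges_simps)
  qed
  ultimately show ?thesis unfolding d_separated_def by blast
qed

lemma d_separated_iff_not_confounded:
  "d_separated (aug_edges E K N) {Obs T k j} {Obs Y k i} {Obs T k i, Obs X k i, Obs X k j} \<longleftrightarrow>
     \<not> ((U, T) \<in> E \<and> (U, Y) \<in> E)"
  using d_separated_if_no_edge_U_Y d_separated_if_no_edge_U_T not_d_separated_if_confounded by blast

end

theorem theorem1:
  fixes M :: "'w measure"
    and E :: "(var \<times> var) set"
    and K :: nat
    and N :: "nat \<Rightarrow> nat"
    and d :: "var \<Rightarrow> nat"
    and S :: "var \<Rightarrow> 'p measure"
    and \<mu> :: "(var \<Rightarrow> 'p) measure"
    and \<kappa> :: "var \<Rightarrow> 'p \<times> (var \<Rightarrow> nat \<Rightarrow> real) \<Rightarrow> (nat \<Rightarrow> real) measure"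
    and \<Theta> :: "var \<Rightarrow> nat \<Rightarrow> 'w \<Rightarrow> 'p"
    and Z :: "var \<Rightarrow> nat \<Rightarrow> nat \<Rightarrow> 'w \<Rightarrow> nat \<Rightarrow> real"
    and k :: nat
  assumes "acyclic E"
    and "(Y, T) \<notin> E\<^sup>+"
    and "(X, T) \<in> E" and "(X, Y) \<in> E"
    and "K \<ge> 1"
    and "\<forall>k\<in>{1..K}. N k \<ge> 2"
    and "hierarchical_model M E K N d S \<mu> \<kappa> \<Theta> Z"
    and "causal_markov M (vertex_algebra M d S \<Theta> Z) (aug_vertices K N) (aug_edges E K N)"
    and "faithful M (vertex_algebra M d S \<Theta> Z) (aug_vertices K N) (aug_edges E K N)"
    and "k \<in> {1..K}"
  shows "(U, T) \<in> E \<and> (U, Y) \<in> E \<longleftrightarrow>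
    (\<forall>i\<in>{1..N k}. \<forall>j\<in>{1..N k}. i \<noteq> j \<longrightarrow>
       \<not> cond_indep M (vertex_algebra M d S \<Theta> Z)
           {Obs T k j} {Obs Y k i} {Obs T k i, Obs X k i, Obs X k j})"
proof -
  have cond_indep_iff: "cond_indep M (vertex_algebra M d S \<Theta> Z)
      {Obs T k j} {Obs Y k i} {Obs T k i, Obs X k i, Obs X k j} \<longleftrightarrow>
      \<not> ((U, T) \<in> E \<and> (U, Y) \<in> E)"
    if "i \<in> {1..N k}" "j \<in> {1..N k}" "i \<noteq> j" for i j
  proof -
    have "cond_indep M (vertex_algebra M d S \<Theta> Z)
        {Obs T k j} {Obs Y k i} {Obs T k i, Obs X k i, Obs X k j} \<longleftrightarrow>
        d_separated (aug_edges E K N) {Obs T k j} {Obs Y k i} {Obs T k i, Obs X k i, Obs X k j}"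
      using that assms(10)
      by (intro cond_indep_iff_d_separated[OF assms(8,9)]) (auto simp: aug_vertices_def)
    also have "\<dots> \<longleftrightarrow> \<not> ((U, T) \<in> E \<and> (U, Y) \<in> E)"
      by (rule d_separated_iff_not_confounded) (use assms that in auto)
    finally show ?thesis .
  qed
  \<comment> \<open>With two observations the quantification over pairs is not vacuous, and a single
    pair already decides confounding.\<close>
  have "1 \<in> {1..N k}" "2 \<in> {1..N k}" "(1::nat) \<noteq> 2"
    using assms(6,10) by fastforce+
  with cond_indep_iff show ?thesis by blast
qed

end
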